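(* Every Any Fit algorithm is absolutely $3$-competitive for Black and White Bin Packing: on every input sequence $L$ it uses at most $3\cdot\mathrm{OPT}(L)$ bins.
   Context: Black and White Bin Packing: items arrive as a sequence; each item has a size in $[0,1]$ and a color that is either black or white. A packing places items into unit-capacity bins, items in a bin ordered by arrival; it is valid if each bin has total size at most $1$ and the colors of consecutive items in each bin alternate (no two consecutive items in a bin have the same color). $\mathrm{OPT}(L)$ is the minimum number of bins in a valid packing of $L$ without reordering. An Any Fit algorithm is an online algorithm that packs each incoming item into some already existing bin whenever there is a bin into which it can be validly added (the choice among such bins is arbitrary and depends on the algorithm), and opens a new bin only when there is no such bin. *)

theory Defs
  imports Complex_Main
begin

datatype color = Black | White

datatype item = Item (item_size: real) (item_color: color)

definition is_input :: "item list \<Rightarrow> bool" where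
  "is_input L \<longleftrightarrow> (\<forall>x \<in> set L. 0 \<le> item_size x \<and> item_size x \<le> 1)"

text \<open>The list lists the items of a bin in order of arrival.\<close>

definition valid_bin :: "item list \<Rightarrow> bool" where
  "valid_bin xs \<longleftrightarrow>
     sum_list (map item_size xs) \<le> 1 \<and>
     successively (\<lambda>x y. item_color x \<noteq> item_color y) xs"

text \<open>A packing of \<open>L\<close> is the list \<open>p\<close> of bin labels assigned to the items of \<open>L\<close>, position by
  position. The labels are arbitrary natural numbers, and the bins used are the elements of
  \<open>set p\<close>, so a bin exists only once it has received an item.\<close>

definition bin_items :: "item list \<Rightarrow> nat list \<Rightarrow> nat \<Rightarrow> item list" where
  "bin_items L p b = map fst (filter (\<lambda>(x, c). c = b) (zip L p))"

definition valid_packing :: "item list \<Rightarrow> nat list \<Rightarrow> bool" where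
  "valid_packing L p \<longleftrightarrow> length p = length L \<and> (\<forall>b \<in> set p. valid_bin (bin_items L p b))"

definition num_bins :: "nat list \<Rightarrow> nat" where
  "num_bins p = card (set p)"

definition OPT :: "item list \<Rightarrow> nat" where
  "OPT L = (LEAST m. \<exists>p. valid_packing L p \<and> num_bins p = m)"

text \<open>An online algorithm maps the nonempty sequence of items that have arrived so far to the bin
  that receives the last of them. Its earlier decisions are determined by the shorter prefixes,
  so they need not be passed as an argument.\<close>

type_synonym online_algorithm = "item list \<Rightarrow> nat"

definition run :: "online_algorithm \<Rightarrow> item list \<Rightarrow> nat list" where
  "run A L = map (\<lambda>i. A (take (Suc i) L)) [0..<length L]"

definition can_add :: "item list \<Rightarrow> nat list \<Rightarrow> item \<Rightarrow> nat \<Rightarrow> bool" where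
  "can_add L p x b \<longleftrightarrow> valid_bin (bin_items L p b @ [x])"

definition any_fit :: "online_algorithm \<Rightarrow> bool" where
  "any_fit A \<longleftrightarrow>
     (\<forall>L x. is_input (L @ [x]) \<longrightarrow>
        (let p = run A L; b = A (L @ [x]) in
           if \<exists>b' \<in> set p. can_add L p x b'
           then b \<in> set p \<and> can_add L p x b
           else b \<notin> set p))"

definition absolutely_competitive :: "real \<Rightarrow> online_algorithm \<Rightarrow> bool" where
  "absolutely_competitive r A \<longleftrightarrow>
     (\<forall>L. is_input L \<longrightarrow> real (num_bins (run A L)) \<le> r * real (OPT L))"

lemma length_run [simp]: "length (run A L) = length L"
  by (simp add: run_def)

lemma run_Nil [simp]: "run A [] = []"
  by (simp add: run_def)

lemma run_snoc [simp]: "run A (L @ [x]) = run A L @ [A (L @ [x])]"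
  by (simp add: run_def)

lemma bin_items_snoc:
  "length p = length L \<Longrightarrow>
   bin_items (L @ [x]) (p @ [c]) b = bin_items L p b @ (if c = b then [x] else [])"
  by (simp add: bin_items_def)

lemma bin_items_unused: "b \<notin> set p \<Longrightarrow> bin_items L p b = []"
  by (auto simp: bin_items_def filter_empty_conv dest: set_zip_rightD)

lemma any_fit_valid_packing:
  assumes "any_fit A" "is_input L"
  shows "valid_packing L (run A L)"
  using assms(2)
proof (induction L rule: rev_induct)
  case Nil
  show ?case by (simp add: valid_packing_def)
next
  case (snoc x L)
  define b where "b = A (L @ [x])"
  have v: "valid_packing L (run A L)"
    using snoc by (auto simp: is_input_def)
  have x1: "item_size x \<le> 1"
    using snoc.prems by (simp add: is_input_def)
  have "b \<in> set (run A L) \<and> can_add L (run A L) x b \<or> b \<notin> set (run A L)"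
    using assms(1) snoc.prems unfolding any_fit_def Let_def b_def by meson
  then have "valid_bin (bin_items L (run A L) b @ [x])"
    using x1 by (auto simp: can_add_def bin_items_unused valid_bin_def)
  then show ?case
    using v by (auto simp: valid_packing_def bin_items_snoc b_def)
qed

lemma ex_any_fit: "\<exists>A. any_fit A"
proof -
  define good where "good L x p b \<longleftrightarrow>
    (if \<exists>b' \<in> set p. can_add L p x b' then b \<in> set p \<and> can_add L p x b else b \<notin> set p)"
    for L x p b
  have ex: "\<exists>b. good L x p b" for L x p
    unfolding good_def using ex_new_if_finite[OF infinite_UNIV_nat, of "set p"] by auto
  define P where "P = rec_nat (\<lambda>L. [])
    (\<lambda>n f L. let p = f (butlast L) in p @ [SOME b. good (butlast L) (last L) p b])"
  define A where "A L = last (P (length L) L)" for L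
  have PS: "P (Suc n) L = P n (butlast L) @ [SOME b. good (butlast L) (last L) (P n (butlast L)) b]"
    for n L by (simp add: P_def Let_def)
  have run: "run A L = P (length L) L" for L
  proof (induction L rule: rev_induct)
    case (snoc x L)
    then show ?case by (simp add: PS A_def)
  qed (simp add: P_def)
  have "good L x (run A L) (A (L @ [x]))" for L x
    using someI_ex[OF ex[of L x "run A L"]] by (simp add: A_def PS run)
  then show ?thesis
    unfolding any_fit_def Let_def good_def by blast
qed

lemma OPT_attained:
  assumes "is_input L"
  shows "\<exists>p. valid_packing L p \<and> num_bins p = OPT L"
proof -
  obtain A where "any_fit A" using ex_any_fit by blast
  then have "\<exists>m p. valid_packing L p \<and> num_bins p = m"
    using any_fit_valid_packing assms by blast
  then show ?thesis unfolding OPT_def by (rule LeastI_ex)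
qed

end

theory Submission imports Defs begin

text \<open>Let \<open>S\<close> be the total size, so \<open>S \<le> OPT\<close>. For \<open>t \<le> 1/2\<close> let \<open>K\<close> be the Any Fit bins of final
  load at most \<open>t\<close> and \<open>H\<close> those of load above \<open>1 - t\<close>. An item of a \<open>K\<close>-bin never fails to fit
  by size into a bin outside \<open>H\<close>, so when it opens a bin, all bins outside \<open>H\<close> have its color on
  top. Comparing the colors on top in the Any Fit packing and in an optimal packing then yields
  \<open>|K| \<le> |H| + OPT\<close>. By a Hall-type argument all but \<open>OPT\<close> of the bins of load at most \<open>1/2\<close>
  can be matched to distinct bins with which they have total load above 1, so the number of bins
  is at most \<open>2 S + OPT \<le> 3 OPT\<close>.\<close>

section \<open>Loads and top colors of bins\<close>

definition bin_load :: "item list \<Rightarrow> nat list \<Rightarrow> nat \<Rightarrow> real" where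
  "bin_load L p b = sum_list (map item_size (bin_items L p b))"

text \<open>These are the bins blocked for a further item of color \<open>c\<close>, whatever its
  size.\<close>

definition tops :: "item list \<Rightarrow> nat list \<Rightarrow> color \<Rightarrow> nat set" where
  "tops L p c = {b \<in> set p. item_color (last (bin_items L p b)) = c}"

lemma finite_tops [simp]: "finite (tops L p c)"
  by (simp add: tops_def)

lemma tops_subset: "tops L p c \<subseteq> set p"
  by (auto simp: tops_def)

lemma card_tops_le: "card (tops L p c) \<le> card (set p)"
  by (simp add: card_mono tops_subset)

lemma tops_other: "c \<noteq> c' \<Longrightarrow> b \<in> set p \<Longrightarrow> b \<notin> tops L p c \<Longrightarrow> b \<in> tops L p c'"
  by (cases c; cases c') (auto simp: tops_def intro: color.exhaust)

lemma tops_snoc: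
  "length p = length L \<Longrightarrow>
   tops (L @ [x]) (p @ [b]) c =
     (if item_color x = c then insert b (tops L p c) else tops L p c - {b})"
  by (auto simp: tops_def bin_items_snoc)

lemma bin_load_snoc:
  "length p = length L \<Longrightarrow>
   bin_load (L @ [x]) (p @ [c]) b = bin_load L p b + (if c = b then item_size x else 0)"
  by (simp add: bin_load_def bin_items_snoc)

lemma is_input_snoc:
  "is_input (L @ [x]) \<longleftrightarrow> is_input L \<and> 0 \<le> item_size x \<and> item_size x \<le> 1"
  by (auto simp: is_input_def)

lemma bin_load_nonneg: "is_input L \<Longrightarrow> 0 \<le> bin_load L p b"
  by (auto simp: bin_load_def bin_items_def is_input_def dest!: set_zip_leftD intro!: sum_list_nonneg)

lemma bin_items_nonempty:
  assumes "length p = length L" "b \<in> set p"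
  shows "bin_items L p b \<noteq> []"
proof -
  obtain i where "i < length p" "p ! i = b" using assms(2) by (auto simp: in_set_conv_nth)
  then have "(L ! i, b) \<in> set (zip L p)" using assms(1) by (auto simp: set_zip)
  then show ?thesis by (auto simp: bin_items_def filter_empty_conv)
qed

text \<open>Sizes are nonnegative, so undoing the last placement keeps every bin valid; alternation
  forbids placing \<open>x\<close> on its own color. In the induction on top colors this serves both
  the Any Fit packing and the packing it is compared with.\<close>

lemma valid_packing_snocD:
  assumes "is_input (L @ [x])" "length p = length L" "valid_packing (L @ [x]) (p @ [b])"
  shows "valid_packing L p" "b \<notin> tops L p (item_color x)"
proof -
  have x: "0 \<le> item_size x" using assms(1) by (simp add: is_input_snoc)
  have v: "valid_bin (bin_items L p b @ [x])"
    using assms(2,3) by (auto simp: valid_packing_def bin_items_snoc)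
  have "valid_bin (bin_items L p a)" if "a \<in> set p" for a
  proof (cases "a = b")
    case True
    then show ?thesis using v x by (auto simp: valid_bin_def successively_append_iff)
  next
    case False
    then show ?thesis using assms(2,3) that by (auto simp: valid_packing_def bin_items_snoc)
  qed
  then show "valid_packing L p" using assms(2) by (simp add: valid_packing_def)
  show "b \<notin> tops L p (item_color x)"
    using v bin_items_nonempty[OF assms(2)]
    by (auto simp: tops_def valid_bin_def successively_append_iff)
qed

lemma sum_bin_load:
  assumes "length p = length L" "finite B" "set p \<subseteq> B"
  shows "(\<Sum>b\<in>B. bin_load L p b) = sum_list (map item_size L)"
  using assms
proof (induction L arbitrary: p rule: rev_induct)
  case Nil
  then show ?case by (simp add: bin_load_def bin_items_def)
next
  case (snoc x L)
  then obtain p' b where p: "p = p' @ [b]" "length p' = length L"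
    by (cases p rule: rev_cases) auto
  then show ?case using snoc by (simp add: bin_load_snoc sum.distrib)
qed

lemma total_size_le_num_bins:
  assumes "valid_packing L q"
  shows "sum_list (map item_size L) \<le> num_bins q"
proof -
  have "sum_list (map item_size L) = (\<Sum>b\<in>set q. bin_load L q b)"
    using assms by (simp add: sum_bin_load valid_packing_def)
  also have "\<dots> \<le> (\<Sum>b\<in>set q. 1)"
    using assms by (intro sum_mono) (auto simp: valid_packing_def valid_bin_def bin_load_def)
  finally show ?thesis by (simp add: num_bins_def)
qed

section \<open>Top colors of Any Fit against an arbitrary valid packing\<close>

lemma any_fit_open:
  assumes "any_fit A" "is_input (L @ [x])" "A (L @ [x]) \<notin> set (run A L)"
    and "b \<in> set (run A L)" "bin_load L (run A L) b + item_size x \<le> 1"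
  shows "b \<in> tops L (run A L) (item_color x)"
proof -
  \<comment> \<open>Opening a bin means that every existing bin refuses \<open>x\<close>; where
    there is room, only the color can be the reason.\<close>
  have "\<not> can_add L (run A L) x b"
    using assms(1-4) unfolding any_fit_def Let_def by meson
  moreover have "valid_bin (bin_items L (run A L) b)"
    using any_fit_valid_packing[OF assms(1)] assms(2,4)
    by (auto simp: is_input_snoc valid_packing_def)
  ultimately show ?thesis
    using assms(4,5)
    by (auto simp: can_add_def valid_bin_def successively_append_iff tops_def bin_load_def)
qed

text \<open>The second conjunct is the bound wanted. It can only be endangered when a bin of
  \<open>K\<close> opens, and at that moment the first conjunct, an inequality that survives every
  single arrival, supplies it. \<open>K\<close> and \<open>H\<close> stay fixed over time.\<close>

lemma top_color_invariant:
  assumes "any_fit A" "is_input L" "valid_packing L q" "finite H" "K \<inter> H = {}"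
    and "\<And>b. b \<in> set (run A L) \<inter> K \<Longrightarrow> bin_load L (run A L) b \<le> t"
    and "\<And>b. b \<in> set (run A L) - H \<Longrightarrow> bin_load L (run A L) b \<le> 1 - t"
  shows "(\<forall>c c'. c \<noteq> c' \<longrightarrow>
            card (tops L (run A L) c \<inter> K) \<le> card (tops L q c) + card (tops L (run A L) c' - K))
         \<and> card (set (run A L) \<inter> K) \<le> card (set q) + card H"
  using assms(2,3,6,7)
proof (induction L arbitrary: q rule: rev_induct)
  case Nil
  then show ?case by (simp add: tops_def)
next
  case (snoc x L)
  obtain q' e where q: "q = q' @ [e]" and lq: "length q' = length L"
    using snoc.prems(2) by (cases q rule: rev_cases) (auto simp: valid_packing_def)
  define p where "p = run A L"
  define b where "b = A (L @ [x])"
  define d where "d = item_color x"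
  have run: "run A (L @ [x]) = p @ [b]" and lp: "length p = length L"
    by (auto simp: p_def b_def)
  have x: "0 \<le> item_size x" and inp: "is_input L" using snoc.prems(1) by (auto simp: is_input_snoc)
  note vq = valid_packing_snocD[OF snoc.prems(1) lq snoc.prems(2)[unfolded q], folded d_def]
  note vp = valid_packing_snocD[OF snoc.prems(1) lp
      any_fit_valid_packing[OF assms(1) snoc.prems(1), unfolded run], folded d_def]
  \<comment> \<open>Loads only grow, so the load conditions on \<open>K\<close> and \<open>H\<close>
    pass to the prefix.\<close>
  have load_mono: "bin_load L p a \<le> bin_load (L @ [x]) (p @ [b]) a" for a
    using x lp by (simp add: bin_load_snoc)
  have load_K: "bin_load (L @ [x]) (p @ [b]) a \<le> t" if "a \<in> set (p @ [b])" "a \<in> K" for a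
    using snoc.prems(3)[unfolded run] that by blast
  have load_H: "bin_load (L @ [x]) (p @ [b]) a \<le> 1 - t" if "a \<in> set (p @ [b])" "a \<notin> H" for a
    using snoc.prems(4)[unfolded run] that by blast
  have IH: "(\<forall>c c'. c \<noteq> c' \<longrightarrow>
            card (tops L p c \<inter> K) \<le> card (tops L q' c) + card (tops L p c' - K))
         \<and> card (set p \<inter> K) \<le> card (set q') + card H"
    unfolding p_def
  proof (rule snoc.IH[OF inp vq(1)])
    show "bin_load L (run A L) a \<le> t" if "a \<in> set (run A L) \<inter> K" for a
      using load_mono[of a] load_K[of a] that by (auto simp: p_def)
    show "bin_load L (run A L) a \<le> 1 - t" if "a \<in> set (run A L) - H" for a
      using load_mono[of a] load_H[of a] that by (auto simp: p_def)
  qed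
  \<comment> \<open>The load of \<open>b\<close> bounds the size of \<open>x\<close> by
    \<open>t\<close>, so \<open>x\<close> has room in every bin outside \<open>H\<close>.\<close>
  have opened: "a \<in> tops L p d" if "b \<notin> set p" "b \<in> K" "a \<in> set p" "a \<notin> H" for a
  proof -
    have "item_size x \<le> t"
      using load_K[of b] that bin_load_nonneg[OF inp, of p b] lp by (simp add: bin_load_snoc)
    moreover have "bin_load L p a \<le> 1 - t"
      using load_mono[of a] load_H[of a] that by auto
    ultimately show ?thesis
      using any_fit_open[OF assms(1) snoc.prems(1), of a] that unfolding p_def b_def d_def by auto
  qed
  have inv: "card (tops (L @ [x]) (p @ [b]) c \<inter> K)
      \<le> card (tops (L @ [x]) q c) + card (tops (L @ [x]) (p @ [b]) c' - K)" if cc: "c \<noteq> c'" for c c'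
  proof -
    have IHc: "card (tops L p c \<inter> K) \<le> card (tops L q' c) + card (tops L p c' - K)"
      using IH cc by blast
    show ?thesis
    proof (cases "d = c")
      case True
      \<comment> \<open>The gain of exactly one in \<open>q\<close> pays for a gain on the left if
        \<open>b\<close> is in \<open>K\<close>, and otherwise for the possible loss of
        \<open>b\<close> from the last term.\<close>
      have tq: "card (tops (L @ [x]) q c) = Suc (card (tops L q' c))"
        using vq(2) True lq by (simp add: tops_snoc q d_def)
      have tp: "tops (L @ [x]) (p @ [b]) c = insert b (tops L p c)"
        "tops (L @ [x]) (p @ [b]) c' = tops L p c' - {b}"
        using True cc lp by (auto simp: tops_snoc d_def)
      show ?thesis
      proof (cases "b \<in> K")
        case True
        then have "tops L p c' - {b} - K = tops L p c' - K"
          "insert b (tops L p c) \<inter> K = insert b (tops L p c \<inter> K)" by auto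
        moreover have "card (insert b (tops L p c \<inter> K)) \<le> Suc (card (tops L p c \<inter> K))"
          by (rule card_insert_le_m1) auto
        ultimately show ?thesis using IHc tq tp by simp
      next
        case False
        then have "tops L p c' - {b} - K = (tops L p c' - K) - {b}"
          "insert b (tops L p c) \<inter> K = tops L p c \<inter> K" by auto
        moreover have "card (tops L p c' - K) \<le> Suc (card ((tops L p c' - K) - {b}))"
          by (auto simp: card_Diff_singleton_if)
        ultimately show ?thesis using IHc tq tp by simp
      qed
    next
      case False
      then have d: "d = c'" using cc by (cases c; cases c'; cases d) auto
      \<comment> \<open>The possible loss of one in \<open>q\<close> must be made up: an old bin of
        \<open>K\<close> that takes \<open>x\<close> showed \<open>c\<close> before, so the left
        side drops too; a bin outside \<open>K\<close> newly shows \<open>c'\<close>, so the last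
        term grows.\<close>
      have tq: "card (tops L q' c) \<le> Suc (card (tops (L @ [x]) q c))"
        using False lq by (auto simp: tops_snoc q d_def card_Diff_singleton_if)
      have tp: "tops (L @ [x]) (p @ [b]) c = tops L p c - {b}"
        "tops (L @ [x]) (p @ [b]) c' = insert b (tops L p c')"
        using d cc lp by (auto simp: tops_snoc d_def)
      show ?thesis
      proof (cases "b \<in> K")
        case bK: True
        show ?thesis
        proof (cases "b \<in> set p")
          case True
          then have "b \<in> tops L p c \<inter> K" using tops_other[of c' c b p L] cc vp(2) d bK by auto
          moreover have "(tops L p c - {b}) \<inter> K = (tops L p c \<inter> K) - {b}"
            "insert b (tops L p c') - K = tops L p c' - K" using bK by auto
          ultimately show ?thesis using IHc tq tp by (simp add: card_Diff_singleton)
        next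
          case False
          \<comment> \<open>When a bin of \<open>K\<close> opens, all older bins of
            \<open>K\<close>, being outside \<open>H\<close>, show \<open>c'\<close>; the left side
            vanishes.\<close>
          have "tops L p c \<inter> K = {}"
          proof -
            have False if "a \<in> tops L p c" "a \<in> K" for a
              using opened[OF False bK, of a] that assms(5) cc d by (auto simp: tops_def)
            then show ?thesis by blast
          qed
          then have "tops (L @ [x]) (p @ [b]) c \<inter> K = {}" using tp by auto
          then show ?thesis by simp
        qed
      next
        case False
        then have "insert b (tops L p c') - K = insert b (tops L p c' - K)"
          "(tops L p c - {b}) \<inter> K = tops L p c \<inter> K"
          using tops_subset by auto
        moreover have "b \<notin> tops L p c' - K" using vp(2) d by auto
        ultimately show ?thesis using IHc tq tp by simp
      qed
    qed
  qed
  have "card (set (p @ [b]) \<inter> K) \<le> card (set q) + card H"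
  proof (cases "b \<in> set p \<or> b \<notin> K")
    case True
    then have "set (p @ [b]) \<inter> K = set p \<inter> K" by auto
    moreover have "card (set q') \<le> card (set q)" by (auto simp: q intro: card_mono)
    ultimately show ?thesis using IH by simp
  next
    case False
    obtain d' where d': "d \<noteq> d'" by (cases d) auto
    have tp: "tops (L @ [x]) (p @ [b]) d = insert b (tops L p d)"
      "tops (L @ [x]) (p @ [b]) d' = tops L p d' - {b}"
      using d' lp by (auto simp: tops_snoc d_def)
    \<comment> \<open>Now all bins outside \<open>H\<close> show \<open>d\<close>: the whole of
      \<open>K\<close> is counted by the first conjunct for \<open>d\<close>, and bins showing
      \<open>d'\<close> lie in \<open>H\<close>.\<close>
    have "set (p @ [b]) \<inter> K \<subseteq> tops (L @ [x]) (p @ [b]) d \<inter> K"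
      using opened False assms(5) tp by auto
    then have "card (set (p @ [b]) \<inter> K) \<le> card (tops (L @ [x]) (p @ [b]) d \<inter> K)"
      by (rule card_mono[rotated]) simp
    also have "\<dots> \<le> card (tops (L @ [x]) q d) + card (tops (L @ [x]) (p @ [b]) d' - K)"
      by (rule inv[OF d'])
    also have "card (tops (L @ [x]) (p @ [b]) d' - K) \<le> card H"
      using opened False d' tp by (intro card_mono assms(4)) (auto simp: tops_def)
    also have "card (tops (L @ [x]) q d) \<le> card (set q)" by (rule card_tops_le)
    finally show ?thesis by simp
  qed
  then show ?case using inv run by simp
qed

section \<open>Matching light bins with heavy ones\<close>

text \<open>Greedy form of the deficiency version of Hall's theorem: the least element
  \<open>l\<close> is removed with a partner \<open>h\<close> such that
  \<open>f l + f h > 1\<close>, or alone at the cost of one unit of \<open>d\<close>. Once all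
  values exceed 1/2, the bound is immediate.\<close>

lemma card_le_twice_sum_plus_deficiency:
  fixes f :: "'a \<Rightarrow> real"
  assumes "finite B" "\<And>b. b \<in> B \<Longrightarrow> 0 \<le> f b"
    and "\<And>t. t \<le> 1/2 \<Longrightarrow> card {b\<in>B. f b \<le> t} \<le> card {b\<in>B. f b > 1 - t} + d"
  shows "card B \<le> 2 * sum f B + d"
  using assms
proof (induction "card B" arbitrary: B d rule: less_induct)
  case less
  note fin = less.prems(1)
  show ?case
  proof (cases "\<exists>b\<in>B. f b \<le> 1/2")
    case False
    then have "(\<Sum>b\<in>B. 1/2) \<le> sum f B" by (intro sum_mono) force
    then show ?thesis by simp
  next
    case True
    then have ne: "B \<noteq> {}" by auto
    obtain l where l: "l \<in> B" "\<And>b. b \<in> B \<Longrightarrow> f l \<le> f b"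
      using ne fin by (metis arg_min_if_finite(1) arg_min_least)
    have l2: "f l \<le> 1/2" using True l(2) by force
    show ?thesis
    proof (cases "\<exists>h\<in>B. f l + f h > 1")
      case True
      then obtain h where h: "h \<in> B" "f l + f h > 1" by blast
      then have lh: "l \<noteq> h" using l2 by auto
      define C where "C = B - {l, h}"
      have cB: "card B = card C + 2"
        using l(1) h(1) lh fin card_Diff_subset[of "{l,h}" B] card_mono[of B "{l,h}"]
        by (auto simp: C_def)
      have sB: "sum f B = sum f C + f l + f h"
        using l(1) h(1) lh fin by (simp add: C_def sum_diff)
      \<comment> \<open>For \<open>t \<ge> f l\<close> both counts lose exactly one, since
        \<open>f h > 1 - f l \<ge> 1 - t\<close>; for smaller \<open>t\<close> the left count is 0
        by minimality of \<open>l\<close>.\<close>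
      have "card C \<le> 2 * sum f C + d"
      proof (rule less.hyps)
        show "card C < card B" using cB by simp
        show "finite C" "\<And>b. b \<in> C \<Longrightarrow> 0 \<le> f b" using less.prems by (auto simp: C_def)
        fix t :: real assume t: "t \<le> 1/2"
        show "card {b\<in>C. f b \<le> t} \<le> card {b\<in>C. f b > 1 - t} + d"
        proof (cases "f l \<le> t")
          case True
          have "{b\<in>B. f b \<le> t} = insert l {b\<in>C. f b \<le> t}"
            "{b\<in>B. f b > 1 - t} = insert h {b\<in>C. f b > 1 - t}"
            using True l h l2 t by (auto simp: C_def)
          moreover have "l \<notin> {b\<in>C. f b \<le> t}" "h \<notin> {b\<in>C. f b > 1 - t}" "finite C"
            using fin by (auto simp: C_def)
          ultimately show ?thesis using less.prems(3)[OF t] by simp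
        next
          case False
          then have "{b\<in>C. f b \<le> t} = {}" using l(2) by (force simp: C_def)
          then show ?thesis by (simp only: card.empty le0)
        qed
      qed
      then show ?thesis using cB sB h(2) by simp
    next
      case False
      define C where "C = B - {l}"
      have cB: "card B = card C + 1"
        using card.remove[OF fin l(1)] by (simp add: C_def)
      have sB: "sum f B = sum f C + f l"
        using l(1) fin by (simp add: C_def sum_diff1)
      \<comment> \<open>The hypothesis at \<open>t = f l\<close> shows that an unmatched
        \<open>l\<close> forces positive deficiency, so \<open>d - 1\<close> below is a genuine
        subtraction.\<close>
      have "card {b\<in>B. f b > 1 - f l} = 0" using False by (force simp: card_eq_0_iff)
      moreover have "card {b\<in>B. f b \<le> f l} > 0" using l fin by (auto simp: card_gt_0_iff)
      ultimately have d: "d > 0" using less.prems(3)[OF l2] by linarith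
      \<comment> \<open>For \<open>t \<ge> f l\<close> only the left count drops, which balances the
        smaller deficiency.\<close>
      have "card C \<le> 2 * sum f C + (d - 1 :: nat)"
      proof (rule less.hyps)
        show "card C < card B" using cB by simp
        show "finite C" "\<And>b. b \<in> C \<Longrightarrow> 0 \<le> f b" using less.prems by (auto simp: C_def)
        fix t :: real assume t: "t \<le> 1/2"
        show "card {b\<in>C. f b \<le> t} \<le> card {b\<in>C. f b > 1 - t} + (d - 1)"
        proof (cases "f l \<le> t")
          case True
          have "{b\<in>B. f b \<le> t} = insert l {b\<in>C. f b \<le> t}"
            "{b\<in>B. f b > 1 - t} = {b\<in>C. f b > 1 - t}"
            using True l l2 t by (auto simp: C_def)
          moreover have "l \<notin> {b\<in>C. f b \<le> t}" "finite C"
            using fin by (auto simp: C_def)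
          ultimately show ?thesis using less.prems(3)[OF t] d by simp
        next
          case False
          then have "{b\<in>C. f b \<le> t} = {}" using l(2) by (force simp: C_def)
          then show ?thesis by (simp only: card.empty le0)
        qed
      qed
      moreover have "0 \<le> f l" using less.prems(2) l(1) by blast
      ultimately show ?thesis using cB sB d by (simp add: of_nat_diff)
    qed
  qed
qed

section \<open>The competitive ratio\<close>

theorem theorem5p1:
  fixes A :: online_algorithm
  assumes "any_fit A"
  shows "absolutely_competitive 3 A"
  unfolding absolutely_competitive_def
proof (intro allI impI)
  fix L assume inp: "is_input L"
  obtain q where q: "valid_packing L q" "num_bins q = OPT L" using OPT_attained[OF inp] by blast
  define B where "B = set (run A L)"
  define f where "f = bin_load L (run A L)"
  have "card {b\<in>B. f b \<le> t} \<le> card {b\<in>B. f b > 1 - t} + OPT L" if t: "t \<le> 1/2" for t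
  proof -
    define K where "K = {b\<in>B. f b \<le> t}"
    define H where "H = {b\<in>B. f b > 1 - t}"
    \<comment> \<open>Disjointness of \<open>K\<close> and \<open>H\<close> is where
      \<open>t \<le> 1/2\<close> enters.\<close>
    have "card (set (run A L) \<inter> K) \<le> card (set q) + card H"
      by (rule conjunct2[OF top_color_invariant[OF assms inp q(1), where t = t]])
        (use t in \<open>auto simp: K_def H_def B_def f_def\<close>)
    moreover have "set (run A L) \<inter> K = K" by (auto simp: K_def B_def)
    ultimately show ?thesis using q(2) by (simp add: K_def H_def num_bins_def)
  qed
  then have "card B \<le> 2 * sum f B + OPT L"
    by (intro card_le_twice_sum_plus_deficiency)
      (auto simp: B_def f_def bin_load_nonneg[OF inp])
  moreover have "sum f B \<le> OPT L"
    using total_size_le_num_bins[OF q(1)] q(2) by (simp add: B_def f_def sum_bin_load)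
  ultimately show "real (num_bins (run A L)) \<le> 3 * real (OPT L)"
    by (simp add: num_bins_def B_def)
qed

end
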